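(* Let $k \ge 2$ be an integer and $n \ge k+1$. If $\mathcal{F} \subseteq 2^{[n]}$ contains neither $Y_k$ nor $Y'_k$ as an induced subposet and $\varnothing \notin \mathcal{F}$, $[n] \notin \mathcal{F}$, then $$\sum_{F\in \mathcal{F}} \binom{n}{|F|}^{-1} \le k.$$ In particular, $|\mathcal{F}|\le \Sigma(n,k)$.
   Context: $[n]=\{1,\dots,n\}$ and $2^{[n]}$ is ordered by inclusion. For an integer $k\ge 2$, the poset $Y_k$ consists of $k+2$ distinct elements $x_1,\dots,x_k,y_1,y_2$ with $x_1 < x_2 < \dots < x_k$ and $x_k < y_1$, $x_k < y_2$ (and the relations implied by transitivity; $y_1,y_2$ incomparable). $Y'_k$ is the dual (reversed) poset of $Y_k$. A poset $P$ is contained in a family $\mathcal{F}$ as an induced subposet if there is an injection $\alpha: P \to \mathcal{F}$ with $x_1 <_P x_2 \iff \alpha(x_1) \subsetneq \alpha(x_2)$ for all $x_1,x_2 \in P$. $\Sigma(n,k)$ denotes the sum of the $k$ largest binomial coefficients $\binom{n}{i}$, $0\le i\le n$. *)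

theory Defs
  imports Complex_Main
begin

text \<open>A finite poset is given by its carrier \<open>P\<close> and its strict order \<open>lt\<close>, of which only the
  restriction to \<open>P\<close> matters.\<close>

definition contains_induced ::
    "'p set \<Rightarrow> ('p \<Rightarrow> 'p \<Rightarrow> bool) \<Rightarrow> 'a set set \<Rightarrow> bool" where
  "contains_induced P lt \<F> \<longleftrightarrow>
     (\<exists>\<alpha>. inj_on \<alpha> P \<and> \<alpha> ` P \<subseteq> \<F> \<and> (\<forall>p\<in>P. \<forall>q\<in>P. lt p q \<longleftrightarrow> \<alpha> p \<subset> \<alpha> q))"

datatype Y_elem = X nat | Y nat

definition Y_carrier :: "nat \<Rightarrow> Y_elem set" where
  "Y_carrier k = X ` {1..k} \<union> Y ` {1, 2}"

fun Y_less :: "Y_elem \<Rightarrow> Y_elem \<Rightarrow> bool" where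
  "Y_less (X i) (X j) \<longleftrightarrow> i < j"
| "Y_less (X i) (Y j) \<longleftrightarrow> True"
| "Y_less (Y i) q \<longleftrightarrow> False"

definition contains_Y :: "nat \<Rightarrow> 'a set set \<Rightarrow> bool" where
  "contains_Y k \<F> \<longleftrightarrow> contains_induced (Y_carrier k) Y_less \<F>"

definition contains_Y_dual :: "nat \<Rightarrow> 'a set set \<Rightarrow> bool" where
  "contains_Y_dual k \<F> \<longleftrightarrow> contains_induced (Y_carrier k) (\<lambda>p q. Y_less q p) \<F>"

text \<open>The \<open>k\<close> largest binomial coefficients are counted with multiplicity, one for each index
  \<open>0 \<le> i \<le> n\<close>.\<close>

definition largest_binomials_sum :: "nat \<Rightarrow> nat \<Rightarrow> nat" where
  "largest_binomials_sum n k = sum_list (take k (rev (sort (map (\<lambda>i. n choose i) [0..<Suc n]))))"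

end

theory Submission
  imports Defs "HOL-Combinatorics.Multiset_Permutations"
begin

text \<open>Double count full chains of the Boolean lattice by the number of family members they meet. A
  chain meeting \<open>m > k\<close> members \<open>F\<^sub>1 \<subset> \<dots> \<subset> F\<^sub>m\<close> has \<open>m - k\<close> windows of \<open>k - 1\<close> consecutive members
  \<open>P \<subset> \<dots> \<subset> Q\<close> with further members both below and above. Complement the chain inside
  \<open>[{}, P]\<close> and inside \<open>[Q, V]\<close>, keeping the part between: by freeness the members below \<open>P\<close> form
  a chain, as do those above \<open>Q\<close>, so the new full chain meets exactly the members of the window.
  Since \<open>P\<close> and \<open>Q\<close> are then the extreme members met, this is an injection from windows to full
  chains with exactly \<open>k - 1\<close> members; hence the surplus over \<open>k\<close> never exceeds the deficit.\<close>

section \<open>Forbidden posets from a chain and an incomparable pair\<close>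

text \<open>The index set is an arbitrary finite set of naturals because the indices will be prefix
  lengths, which need not be consecutive. Listing \<open>T\<close> in increasing order supplies the
  images of the \<open>X\<close> elements; \<open>A\<close> and \<open>B\<close> are the two
  tops.\<close>

lemma contains_Y_chainI:
  fixes g :: "nat \<Rightarrow> 'a set"
  assumes "finite T" "card T = k"
    and g: "g ` T \<subseteq> \<F>" "\<And>i j. i \<in> T \<Longrightarrow> j \<in> T \<Longrightarrow> i < j \<Longrightarrow> g i \<subset> g j"
    and AB: "A \<in> \<F>" "B \<in> \<F>" "\<not> A \<subseteq> B" "\<not> B \<subseteq> A"
    and above: "\<And>i. i \<in> T \<Longrightarrow> g i \<subset> A" "\<And>i. i \<in> T \<Longrightarrow> g i \<subset> B"
  shows "contains_Y k \<F>"
proof -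
  define L where "L = sorted_list_of_set T"
  have len: "length L = k" and setL: "set L = T" using assms(1,2) by (simp_all add: L_def)
  have nth: "L ! i \<in> T" if "i < k" for i
    using that len setL nth_mem[of i L] by simp
  have mono: "L ! i < L ! j" if "i < j" "j < k" for i j
    using that len sorted_wrt_nth_less[OF strict_sorted_list_of_set[of T, folded L_def]] by auto
  \<comment> \<open>\<open>X\<close> labels start at 1 and list positions at 0, hence the
    shift.\<close>
  define \<alpha> where "\<alpha> p = (case p of X i \<Rightarrow> g (L ! (i - 1)) | Y j \<Rightarrow> if j = 1 then A else B)" for p
  have gless: "g (L ! (i - 1)) \<subset> g (L ! (j - 1))" if "1 \<le> i" "i < j" "j \<le> k" for i j
    using that by (intro g nth mono) auto
  have gX: "g (L ! (i - 1)) \<subset> g (L ! (j - 1)) \<longleftrightarrow> i < j" if "i \<in> {1..k}" "j \<in> {1..k}" for i j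
    using gless[of i j] gless[of j i] that by (cases i j rule: linorder_cases) auto
  have gY: "g (L ! (i - 1)) \<subset> A" "g (L ! (i - 1)) \<subset> B" if "i \<in> {1..k}" for i
    using that by (auto intro!: above nth)
  have iff: "Y_less p q \<longleftrightarrow> \<alpha> p \<subset> \<alpha> q" if "p \<in> Y_carrier k" "q \<in> Y_carrier k" for p q
  proof (cases p; cases q)
    fix i j assume "p = X i" "q = X j"
    then show ?thesis using that gX[of i j] by (auto simp: Y_carrier_def \<alpha>_def)
  next
    fix i j assume "p = X i" "q = Y j"
    then show ?thesis using that gY[of i] by (auto simp: Y_carrier_def \<alpha>_def)
  next
    fix i j assume "p = Y i" "q = X j"
    then show ?thesis using that gY[of j] by (auto simp: Y_carrier_def \<alpha>_def)
  next
    fix i j assume "p = Y i" "q = Y j"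
    then show ?thesis using that AB by (auto simp: Y_carrier_def \<alpha>_def)
  qed
  have "inj_on \<alpha> (Y_carrier k)"
  proof (rule inj_onI)
    fix p q assume pq: "p \<in> Y_carrier k" "q \<in> Y_carrier k" "\<alpha> p = \<alpha> q"
    \<comment> \<open>Equal images are not strictly nested, so \<open>iff\<close> leaves only equal
      \<open>X\<close> labels or two \<open>Y\<close> elements, and incomparability of
      \<open>A\<close> and \<open>B\<close> separates the latter.\<close>
    then have "\<not> Y_less p q" "\<not> Y_less q p" using iff by auto
    then show "p = q"
      using pq AB by (cases p; cases q) (auto simp: Y_carrier_def \<alpha>_def split: if_splits)
  qed
  moreover have "\<alpha> ` Y_carrier k \<subseteq> \<F>"
    using g(1) AB nth by (force simp: Y_carrier_def \<alpha>_def)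
  ultimately show ?thesis
    unfolding contains_Y_def contains_induced_def using iff by (intro exI[of _ \<alpha>]) simp
qed

text \<open>Complementation reverses inclusion: with the indices reversed as well,
  \<open>contains_Y_chainI\<close> applies to the family of complements, and complementing the copy
  found there gives the dual.\<close>

lemma contains_Y_dual_chainI:
  fixes g :: "nat \<Rightarrow> 'a set"
  assumes "finite T" "card T = k"
    and g: "g ` T \<subseteq> \<F>" "\<And>i j. i \<in> T \<Longrightarrow> j \<in> T \<Longrightarrow> i < j \<Longrightarrow> g i \<subset> g j"
    and AB: "A \<in> \<F>" "B \<in> \<F>" "\<not> A \<subseteq> B" "\<not> B \<subseteq> A"
    and below: "\<And>i. i \<in> T \<Longrightarrow> A \<subset> g i" "\<And>i. i \<in> T \<Longrightarrow> B \<subset> g i"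
  shows "contains_Y_dual k \<F>"
proof -
  have "contains_Y k (uminus ` \<F>)"
  proof (rule contains_Y_chainI[where A = "- A" and B = "- B"])
    \<comment> \<open>Taking the largest index ensures that \<open>N - i\<close> is never truncated
      on \<open>T\<close>, so it reverses the order injectively.\<close>
    define N where "N = Max T"
    have le: "i \<le> N" if "i \<in> T" for i using that assms(1) by (simp add: N_def)
    show "finite ((\<lambda>i. N - i) ` T)" using assms(1) by simp
    have "inj_on (\<lambda>i. N - i) T" using le by (auto simp: inj_on_def dest!: le)
    then show "card ((\<lambda>i. N - i) ` T) = k" using assms(2) by (simp add: card_image)
    show "(\<lambda>i. - g (N - i)) ` (\<lambda>i. N - i) ` T \<subseteq> uminus ` \<F>"
      using g(1) le by (auto simp: image_iff subset_iff)
    show "- g (N - i) \<subset> - g (N - j)"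
      if ij: "i \<in> (\<lambda>i. N - i) ` T" "j \<in> (\<lambda>i. N - i) ` T" "i < j" for i j
    proof -
      obtain i' j' where "i' \<in> T" "j' \<in> T" "i = N - i'" "j = N - j'" using ij by blast
      then show ?thesis using g(2)[of j' i'] le[of i'] le[of j'] \<open>i < j\<close> by auto
    qed
    show "- g (N - i) \<subset> - A" "- g (N - i) \<subset> - B" if "i \<in> (\<lambda>i. N - i) ` T" for i
      using that below le by (force simp: image_iff)+
  qed (use AB in auto)
  then obtain \<alpha> where \<alpha>: "inj_on \<alpha> (Y_carrier k)" "\<alpha> ` Y_carrier k \<subseteq> uminus ` \<F>"
      "\<forall>p\<in>Y_carrier k. \<forall>q\<in>Y_carrier k. Y_less p q \<longleftrightarrow> \<alpha> p \<subset> \<alpha> q"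
    unfolding contains_Y_def contains_induced_def by blast
  have "inj_on (\<lambda>p. - \<alpha> p) (Y_carrier k)" using \<alpha>(1) by (auto simp: inj_on_def)
  moreover have "(\<lambda>p. - \<alpha> p) ` Y_carrier k \<subseteq> \<F>" using \<alpha>(2) by auto
  moreover have "Y_less q p \<longleftrightarrow> - \<alpha> p \<subset> - \<alpha> q" if "p \<in> Y_carrier k" "q \<in> Y_carrier k" for p q
    using \<alpha>(3) that by auto
  ultimately show ?thesis
    unfolding contains_Y_dual_def contains_induced_def by (intro exI[of _ "\<lambda>p. - \<alpha> p"]) simp
qed

section \<open>Full chains, their hits and windows\<close>

text \<open>A list enumerating the ground set without repetition encodes the full chain of its prefixes;
  a hit is the size of a prefix lying in the family.\<close>

definition hits :: "'a set set \<Rightarrow> 'a list \<Rightarrow> nat set" where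
  "hits \<F> xs = {i. i \<le> length xs \<and> set (take i xs) \<in> \<F>}"

text \<open>The two end positions suffice, since \<open>H\<close> determines the hits between them;
  they are also what can be read off after a flip. The outer hits are what makes a forbidden poset
  arise.\<close>

definition windows :: "nat \<Rightarrow> nat set \<Rightarrow> (nat \<times> nat) set" where
  "windows k H = {(a, b). a \<in> H \<and> b \<in> H \<and> a \<le> b \<and> card (H \<inter> {a..b}) = k - 1 \<and>
     (\<exists>h\<in>H. h < a) \<and> (\<exists>h\<in>H. b < h)}"

text \<open>The first \<open>i\<close> \<le> \<open>a\<close> entries of the reversed initial block
  form the complement, within the first \<open>a\<close> entries, of the prefix of length
  \<open>a - i\<close>; the final block acts likewise above \<open>b\<close>.\<close>

definition flip_ends :: "nat \<Rightarrow> nat \<Rightarrow> 'a list \<Rightarrow> 'a list" where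
  "flip_ends a b xs = rev (take a xs) @ drop a (take b xs) @ rev (drop b xs)"

lemma finite_hits [simp]: "finite (hits \<F> xs)"
  by (rule finite_subset[of _ "{..length xs}"]) (auto simp: hits_def)

lemma finite_windows [simp]: "finite H \<Longrightarrow> finite (windows k H)"
  by (rule finite_subset[of _ "H \<times> H"]) (auto simp: windows_def)

text \<open>In sorted order each hit with a predecessor and at least \<open>k - 1\<close> successors
  starts a window. The additive form also covers fewer than \<open>k\<close> hits.\<close>

lemma card_le_card_windows:
  assumes "finite H" "k \<ge> 2"
  shows "card H \<le> k + card (windows k H)"
proof -
  define L where "L = sorted_list_of_set H"
  have len: "length L = card H" and setL: "set L = H" using assms by (auto simp: L_def)
  have mono: "L ! i < L ! j" if "i < j" "j < card H" for i j
    using that len sorted_wrt_nth_less[OF strict_sorted_list_of_set[of H, folded L_def]] by auto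
  have mono_iff: "L ! i \<le> L ! j \<longleftrightarrow> i \<le> j" if "i < card H" "j < card H" for i j
    using mono[of i j] mono[of j i] that by (cases i j rule: linorder_cases) auto
  have inj: "inj_on ((!) L) {..<card H}"
    using mono_iff by (intro inj_onI) (metis lessThan_iff order_antisym order_refl)
  have H: "H = (!) L ` {..<card H}"
    using len setL by (auto simp: set_conv_nth)
  \<comment> \<open>Positions count from 0: the \<open>k - 1\<close> hits from \<open>i\<close> on
    end at \<open>i + k - 2\<close>, and the range leaves a hit at \<open>i - 1\<close> and one at
    \<open>i + k - 1\<close>.\<close>
  have win: "(L ! i, L ! (i + k - 2)) \<in> windows k H" if "i \<in> {1..card H - k}" for i
  proof -
    have i: "1 \<le> i" "i + k - 2 < card H - 1" "i \<le> i + k - 2" "i < card H"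
      using that assms(2) by auto
    have "H \<inter> {L ! i..L ! (i + k - 2)} = (!) L ` {i..i + k - 2}"
      using i mono_iff by (subst H) auto
    moreover have "inj_on ((!) L) {i..i + k - 2}"
      using i by (intro inj_on_subset[OF inj]) auto
    ultimately have "card (H \<inter> {L ! i..L ! (i + k - 2)}) = k - 1"
      using i assms(2) by (simp add: card_image)
    moreover have "L ! (i - 1) < L ! i" "L ! (i + k - 2) < L ! (i + k - 1)"
      using i assms(2) by (auto intro!: mono)
    moreover have "L ! j \<in> H" if "j < card H" for j
      using that len setL nth_mem[of j L] by auto
    ultimately show ?thesis
      unfolding windows_def using i assms(2) mono_iff[of i "i + k - 2"] by auto
  qed
  have "inj_on (\<lambda>i. (L ! i, L ! (i + k - 2))) {1..card H - k}"
    using inj assms(2) by (auto simp: inj_on_def)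
  then have "card {1..card H - k} \<le> card (windows k H)"
    using win assms(1) by (intro card_inj_on_le) auto
  then show ?thesis by simp
qed

section \<open>Flipping the ends of a chain\<close>

lemma set_take_psubset:
  assumes "distinct xs" "i < j" "j \<le> length xs"
  shows "set (take i xs) \<subset> set (take j xs)"
proof -
  have "card (set (take i xs)) < card (set (take j xs))"
    using assms by (simp add: distinct_card)
  moreover have "set (take i xs) \<subseteq> set (take j xs)"
    using assms by (intro set_take_subset_set_take) simp
  ultimately show ?thesis by auto
qed

lemma take_drop_take_drop:
  assumes "a \<le> b"
  shows "take a xs @ drop a (take b xs) @ drop b xs = xs"
proof -
  have "take a xs @ drop a (take b xs) = take b xs"
    using assms by (metis append_take_drop_id min.absorb1 take_take)
  then show ?thesis
    by (metis append.assoc append_take_drop_id)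
qed

lemma length_flip_ends [simp]: "a \<le> b \<Longrightarrow> b \<le> length xs \<Longrightarrow> length (flip_ends a b xs) = length xs"
  by (simp add: flip_ends_def)

text \<open>Each outer block is reversed in place, so the flip is its own inverse once the cut
  points are known.\<close>

lemma flip_ends_flip_ends:
  assumes "a \<le> b" "b \<le> length xs"
  shows "flip_ends a b (flip_ends a b xs) = xs"
proof -
  show ?thesis
    using assms take_drop_take_drop[OF assms(1), of xs] by (simp add: flip_ends_def)
qed

lemma flip_ends_permutation:
  assumes "xs \<in> permutations_of_set V" "a \<le> b" "b \<le> length xs"
  shows "flip_ends a b xs \<in> permutations_of_set V"
proof -
  have "mset (flip_ends a b xs) = mset xs"
    by (metis assms(2) take_drop_take_drop flip_ends_def mset_append mset_rev)
  then show ?thesis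
    using assms(1) unfolding permutations_of_set_def
    by (metis (mono_tags, lifting) mem_Collect_eq mset_eq_imp_distinct_iff mset_eq_setD)
qed

text \<open>Reversal sends each lower prefix to a set missing the first entry and containing the last
  one, hence incomparable to any hit below the window; likewise above.\<close>

lemma hits_flip_ends:
  assumes xs: "xs \<in> permutations_of_set V" and k: "k \<ge> 2"
    and free: "\<not> contains_Y k \<F>" "\<not> contains_Y_dual k \<F>"
    and ends: "{} \<notin> \<F>" "V \<notin> \<F>"
    and win: "(a, b) \<in> windows k (hits \<F> xs)"
  shows "hits \<F> (flip_ends a b xs) = hits \<F> xs \<inter> {a..b}"
proof -
  define H n ys where "H = hits \<F> xs" and "n = length xs" and "ys = flip_ends a b xs"
  have dist: "distinct xs" and setxs: "set xs = V" using xs by (auto simp: permutations_of_set_def)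
  obtain h l where ab: "a \<in> H" "b \<in> H" "a \<le> b" "card (H \<inter> {a..b}) = k - 1"
    and l: "l \<in> H" "l < a" and h: "h \<in> H" "b < h"
    using win by (auto simp: windows_def H_def)
  \<comment> \<open>As the empty set and \<open>V\<close> are excluded, every hit prefix contains
    \<open>xs ! 0\<close> and misses \<open>xs ! (n - 1)\<close>.\<close>
  have H: "i < n" "0 < i" "set (take i xs) \<in> \<F>" if "i \<in> H" for i
  proof -
    have i: "i \<le> n" "set (take i xs) \<in> \<F>" using that by (auto simp: H_def hits_def n_def)
    have "i \<noteq> n" using i ends setxs by (auto simp: n_def)
    moreover have "i \<noteq> 0"
      using i ends by (cases "i = 0") auto
    ultimately show "i < n" "0 < i" "set (take i xs) \<in> \<F>" using i by auto
  qed
  have bn: "b < n" using H ab by auto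
  have chain: "set (take i xs) \<subset> set (take j xs)" if "i < j" "j \<le> n" for i j
    using that dist set_take_psubset n_def by blast
  have mem: "xs ! j \<in> set (take i xs) \<longleftrightarrow> j < i" if "i \<le> n" "j < n" for i j
    using that dist by (auto simp: in_set_conv_nth nth_eq_iff_index_eq n_def)
  have fin: "finite H" by (simp add: H_def)
  \<comment> \<open>Only the order within the first \<open>a\<close> entries has changed, which
    leaves the set alone.\<close>
  have mid: "set (take i ys) = set (take i xs)" if "a \<le> i" "i \<le> b" for i
  proof -
    have "take i ys = rev (take a xs) @ take (i - a) (drop a (take b xs))"
      using that bn by (simp add: ys_def flip_ends_def n_def)
    moreover have "take i xs = take a xs @ take (i - a) (drop a (take b xs))"
      using that by (simp add: take_drop min_def) (metis append_take_drop_id le_add_diff_inverse min.absorb1 take_take)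
    ultimately show ?thesis by simp
  qed
  have low: "set (take i ys) \<notin> \<F>" if i: "i < a" for i
  proof
    assume G: "set (take i ys) \<in> \<F>"
    \<comment> \<open>A nonempty prefix is needed for it to contain
      \<open>xs ! (a - 1)\<close>.\<close>
    then have "0 < i" using ends by (cases "i = 0") auto
    have ti: "take i ys = rev (drop (a - i) (take a xs))"
      using i ab bn by (simp add: ys_def flip_ends_def n_def take_rev)
    have sub: "set (take i ys) \<subseteq> set (take a xs)"
      unfolding ti by (simp add: set_drop_subset)
    have x0: "xs ! 0 \<notin> set (take i ys)"
    proof -
      have "xs ! 0 \<in> set (take (a - i) xs)" using mem[of "a - i" 0] i ab bn by simp
      moreover have "set (take i ys) \<subseteq> set (drop (a - i) xs)"
        using i by (simp add: ti drop_take set_take_subset)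
      ultimately show ?thesis
        using set_take_disj_set_drop_if_distinct[OF dist order_refl, of "a - i"] by blast
    qed
    have xa: "xs ! (a - 1) \<in> set (take i ys)"
      using \<open>0 < i\<close> i ab bn unfolding ti in_set_conv_nth set_rev
      by (intro exI[of _ "i - 1"]) (auto simp: n_def)
    have xl: "xs ! 0 \<in> set (take l xs)" "xs ! (a - 1) \<notin> set (take l xs)"
      "xs ! 0 \<in> set (take a xs)"
      using mem[of l] mem[of a] H[OF l(1)] H[OF ab(1)] l ab by auto
    \<comment> \<open>The \<open>k - 1\<close> window hits together with \<open>h\<close> form the
      chain; the prefix at \<open>l\<close> and the flipped prefix are the incomparable pair below
      it.\<close>
    have "contains_Y_dual k \<F>"
    proof (rule contains_Y_dual_chainI[where T = "insert h (H \<inter> {a..b})"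
          and g = "\<lambda>i. set (take i xs)" and A = "set (take l xs)" and B = "set (take i ys)"])
      show "card (insert h (H \<inter> {a..b})) = k" using fin h ab k by simp
      fix t assume "t \<in> insert h (H \<inter> {a..b})"
      then have t: "a \<le> t" "t < n" using H h ab by auto
      then have at: "set (take a xs) \<subseteq> set (take t xs)"
        by (simp add: set_take_subset_set_take)
      show "set (take l xs) \<subset> set (take t xs)" using chain l t by simp
      show "set (take i ys) \<subset> set (take t xs)" using sub at x0 xl by blast
    next
      fix i j assume "i \<in> insert h (H \<inter> {a..b})" "j \<in> insert h (H \<inter> {a..b})" "i < j"
      then show "set (take i xs) \<subset> set (take j xs)" using H h by (intro chain) (auto simp: less_imp_le)
    qed (use fin H h l G x0 xa xl in auto)
    then show False using free by simp
  qed
  have high: "set (take i ys) \<notin> \<F>" if i: "b < i" "i \<le> n" for i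
  proof
    assume G: "set (take i ys) \<in> \<F>"
    \<comment> \<open>Length \<open>n\<close> would give \<open>V\<close>; having
      \<open>i < n\<close> is what keeps \<open>xs ! b\<close> out of the flipped prefix.\<close>
    have "length ys = n" using ab bn by (simp add: ys_def n_def)
    moreover have "set ys = V"
      using flip_ends_permutation[OF xs, of a b] ab bn
      by (auto simp: permutations_of_set_def ys_def n_def)
    ultimately have "i < n" using G i ends by (auto simp: order_less_le)
    have ti: "take i ys = take b ys @ rev (drop (n - i) (drop b xs))"
    proof -
      have "take i ys = rev (take a xs) @ drop a (take b xs) @ take (i - b) (rev (drop b xs))"
        using i ab bn by (simp add: ys_def flip_ends_def n_def)
      moreover have "take b ys = rev (take a xs) @ drop a (take b xs)"
        using i ab bn by (simp add: ys_def flip_ends_def n_def)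
      moreover have "take (i - b) (rev (drop b xs)) = rev (drop (n - i) (drop b xs))"
        using i by (simp add: take_rev n_def del: drop_drop)
      ultimately show ?thesis by simp
    qed
    \<comment> \<open>Past \<open>b\<close>, the flipped chain adds the last \<open>i - b\<close>
      entries of \<open>xs\<close>.\<close>
    have tis: "set (take i ys) = set (take b xs) \<union> set (drop (n - i + b) xs)"
      using mid[of b] ab by (simp add: ti)
    have xb: "xs ! b \<notin> set (take i ys)"
    proof -
      have "xs ! b \<in> set (take (n - i + b) xs)" "xs ! b \<notin> set (take b xs)"
        using mem[of "n - i + b" b] mem[of b b] i \<open>i < n\<close> bn by auto
      then show ?thesis
        using set_take_disj_set_drop_if_distinct[OF dist order_refl, of "n - i + b"]
        unfolding tis by blast
    qed
    have xn: "xs ! (n - 1) \<in> set (take i ys)"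
      using i unfolding tis Un_iff in_set_conv_nth[of _ "drop _ _"]
      by (intro disjI2 exI[of _ "i - b - 1"]) (auto simp: n_def)
    have xh: "xs ! b \<in> set (take h xs)" "xs ! (n - 1) \<notin> set (take h xs)"
      "xs ! (n - 1) \<notin> set (take b xs)"
      using mem[of h] mem[of b] H[OF h(1)] h bn by auto
    \<comment> \<open>Here \<open>l\<close> extends the window downwards to a chain of
      \<open>k\<close> sets, below the prefix at \<open>h\<close> and the flipped prefix.\<close>
    have "contains_Y k \<F>"
    proof (rule contains_Y_chainI[where T = "insert l (H \<inter> {a..b})"
          and g = "\<lambda>i. set (take i xs)" and A = "set (take h xs)" and B = "set (take i ys)"])
      show "card (insert l (H \<inter> {a..b})) = k" using fin l ab k by simp
      fix t assume "t \<in> insert l (H \<inter> {a..b})"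
      then have t: "t \<le> b" using l ab by auto
      then have bt: "set (take t xs) \<subseteq> set (take b xs)"
        by (simp add: set_take_subset_set_take)
      show "set (take t xs) \<subset> set (take h xs)" using chain h t H[OF h(1)] by simp
      show "set (take t xs) \<subset> set (take i ys)" using tis bt xn xh by blast
    next
      fix i j assume "i \<in> insert l (H \<inter> {a..b})" "j \<in> insert l (H \<inter> {a..b})" "i < j"
      then show "set (take i xs) \<subset> set (take j xs)" using H l by (intro chain) (auto simp: less_imp_le)
    qed (use fin H h l G xb xn xh in auto)
    then show False using free by simp
  qed
  have len: "length ys = n" using ab bn by (simp add: ys_def n_def)
  show ?thesis
  proof (rule set_eqI)
    fix i
    show "i \<in> hits \<F> (flip_ends a b xs) \<longleftrightarrow> i \<in> hits \<F> xs \<inter> {a..b}"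
      using low[of i] high[of i] mid[of i] bn len
      by (cases "i < a"; cases "i \<le> b") (auto simp: hits_def ys_def n_def)
  qed
qed

section \<open>Injection from windows to deficient chains\<close>

text \<open>Flipping is injective on pairs of a chain and a window: the image reveals the cut
  points, and flipping there again recovers the chain.\<close>

lemma card_windows_le:
  assumes V: "finite V" and k: "k \<ge> 2"
    and free: "\<not> contains_Y k \<F>" "\<not> contains_Y_dual k \<F>"
    and ends: "{} \<notin> \<F>" "V \<notin> \<F>"
  shows "(\<Sum>xs\<in>permutations_of_set V. card (windows k (hits \<F> xs)))
     \<le> card {xs \<in> permutations_of_set V. card (hits \<F> xs) = k - 1}"
proof -
  define W where "W = (SIGMA xs:permutations_of_set V. windows k (hits \<F> xs))"
  define \<phi> :: "'a list \<times> nat \<times> nat \<Rightarrow> 'a list" where "\<phi> = (\<lambda>(xs, a, b). flip_ends a b xs)"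
  have flip: "hits \<F> (flip_ends a b xs) = hits \<F> xs \<inter> {a..b} \<and> a \<le> b \<and> b \<le> length xs \<and>
      a \<in> hits \<F> xs \<and> b \<in> hits \<F> xs \<and> xs \<in> permutations_of_set V \<and> card (hits \<F> xs \<inter> {a..b}) = k - 1"
    if "(xs, a, b) \<in> W" for xs a b
  proof -
    have xs: "xs \<in> permutations_of_set V" and ab: "(a, b) \<in> windows k (hits \<F> xs)"
      using that by (auto simp: W_def)
    have "a \<le> b" "a \<in> hits \<F> xs" "b \<in> hits \<F> xs" "card (hits \<F> xs \<inter> {a..b}) = k - 1"
      using ab by (auto simp: windows_def)
    moreover from this have "b \<le> length xs" by (simp add: hits_def)
    ultimately show ?thesis using xs hits_flip_ends[OF xs k free ends ab] by blast
  qed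
  \<comment> \<open>The surviving hits are exactly those of the window, whose extreme elements are
    \<open>a\<close> and \<open>b\<close>.\<close>
  have ext: "Min (hits \<F> (flip_ends a b xs)) = a" "Max (hits \<F> (flip_ends a b xs)) = b"
    if "(xs, a, b) \<in> W" for xs a b
  proof -
    have "hits \<F> (flip_ends a b xs) = hits \<F> xs \<inter> {a..b}" "a \<in> hits \<F> xs \<inter> {a..b}"
      "b \<in> hits \<F> xs \<inter> {a..b}"
      using flip[OF that] by auto
    then show "Min (hits \<F> (flip_ends a b xs)) = a" "Max (hits \<F> (flip_ends a b xs)) = b"
      by (auto simp del: Int_iff intro!: Min_eqI Max_eqI)
  qed
  have "inj_on \<phi> W"
  proof (rule inj_onI)
    fix p q assume "p \<in> W" "q \<in> W" "\<phi> p = \<phi> q"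
    then obtain xs a b ys c d where pq: "p = (xs, a, b)" "q = (ys, c, d)"
      and W: "(xs, a, b) \<in> W" "(ys, c, d) \<in> W" and eq: "\<phi> (xs, a, b) = \<phi> (ys, c, d)"
      by (metis prod_cases3)
    have "a = c" "b = d" using ext[OF W(1)] ext[OF W(2)] eq by (auto simp: \<phi>_def)
    moreover have "flip_ends a b (flip_ends a b xs) = xs" "flip_ends c d (flip_ends c d ys) = ys"
      using flip[OF W(1)] flip[OF W(2)] by (simp_all only: flip_ends_flip_ends)
    ultimately show "p = q"
      using eq by (metis pq \<phi>_def case_prod_conv)
  qed
  moreover have "\<phi> ` W \<subseteq> {xs \<in> permutations_of_set V. card (hits \<F> xs) = k - 1}"
  proof clarify
    fix xs a b assume "(xs, a, b) \<in> W"
    then show "\<phi> (xs, a, b) \<in> permutations_of_set V \<and> card (hits \<F> (\<phi> (xs, a, b))) = k - 1"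
      using flip[of xs a b] flip_ends_permutation[of xs V a b] by (simp add: \<phi>_def)
  qed
  ultimately have "card W \<le> card {xs \<in> permutations_of_set V. card (hits \<F> xs) = k - 1}"
    using V by (intro card_inj_on_le) auto
  then show ?thesis by (simp add: W_def)
qed

lemma sum_card_hits_le:
  assumes V: "finite V" and k: "k \<ge> 2"
    and free: "\<not> contains_Y k \<F>" "\<not> contains_Y_dual k \<F>"
    and ends: "{} \<notin> \<F>" "V \<notin> \<F>"
  shows "(\<Sum>xs\<in>permutations_of_set V. card (hits \<F> xs)) \<le> k * fact (card V)"
proof -
  let ?P = "permutations_of_set V" and ?d = "\<lambda>xs. if card (hits \<F> xs) = k - 1 then 1 else 0"
  \<comment> \<open>A chain with exactly \<open>k - 1\<close> hits has one to spare, so the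
    indicator fits under the bound; elsewhere it is 0.\<close>
  have "(\<Sum>xs\<in>?P. card (hits \<F> xs) + ?d xs) \<le> (\<Sum>xs\<in>?P. k + card (windows k (hits \<F> xs)))"
    using card_le_card_windows[OF finite_hits k] k by (intro sum_mono) auto
  moreover have "(\<Sum>xs\<in>?P. ?d xs) = card {xs \<in> ?P. card (hits \<F> xs) = k - 1}"
    by (simp add: sum.If_cases Int_def)
  ultimately show ?thesis
    using card_windows_le[OF assms] V by (simp add: sum.distrib mult.commute)
qed

section \<open>From chain counts to the weighted sum\<close>

text \<open>A full chain through \<open>F\<close> is an ordering of \<open>F\<close> followed by an
  ordering of \<open>V - F\<close>.\<close>

lemma card_permutations_with_prefix:
  assumes "finite V" "F \<subseteq> V"
  shows "card {xs \<in> permutations_of_set V. set (take (card F) xs) = F}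
     = fact (card F) * fact (card V - card F)"
proof -
  have fin: "finite F" using assms finite_subset by auto
  let ?S = "{xs \<in> permutations_of_set V. set (take (card F) xs) = F}"
  have "bij_betw (\<lambda>(us, vs). us @ vs) (permutations_of_set F \<times> permutations_of_set (V - F)) ?S"
  proof (rule bij_betw_byWitness[where f' = "\<lambda>xs. (take (card F) xs, drop (card F) xs)"])
    show "(\<lambda>xs. (take (card F) xs, drop (card F) xs)) ` ?S
        \<subseteq> permutations_of_set F \<times> permutations_of_set (V - F)"
    proof clarsimp
      fix xs assume xs: "xs \<in> permutations_of_set V" "set (take (card F) xs) = F"
      then have d: "distinct xs" "set xs = V" by (auto simp: permutations_of_set_def)
      have "set (take (card F) xs) \<union> set (drop (card F) xs) = V"
        using d by (metis append_take_drop_id set_append)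
      moreover have "set (take (card F) xs) \<inter> set (drop (card F) xs) = {}"
        using d by (metis append_take_drop_id distinct_append)
      ultimately show "take (card F) xs \<in> permutations_of_set F \<and>
          drop (card F) xs \<in> permutations_of_set (V - F)"
        using xs d by (auto simp: permutations_of_set_def)
    qed
  qed (use assms in \<open>auto simp: permutations_of_set_def distinct_card[symmetric]\<close>)
  then have "card ?S = card (permutations_of_set F \<times> permutations_of_set (V - F))"
    by (simp add: bij_betw_same_card)
  then show ?thesis using fin assms by (simp add: card_Diff_subset card_cartesian_product)
qed

text \<open>A prefix and its length determine each other, so hits can be counted by family members,
  as the double count requires.\<close>

lemma card_hits_eq:
  assumes "xs \<in> permutations_of_set V" "finite V" "\<F> \<subseteq> Pow V"
  shows "card (hits \<F> xs) = card {F \<in> \<F>. set (take (card F) xs) = F}"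
proof -
  have d: "distinct xs" "set xs = V" using assms by (auto simp: permutations_of_set_def)
  have c: "card (set (take i xs)) = i" if "i \<le> length xs" for i
    using d that by (simp add: distinct_card)
  have "card F \<le> length xs" if "F \<in> \<F>" for F
    using that assms d by (metis PowD card_mono distinct_card subsetD)
  then have "bij_betw (\<lambda>i. set (take i xs)) (hits \<F> xs) {F \<in> \<F>. set (take (card F) xs) = F}"
    by (intro bij_betw_byWitness[where f' = card]) (auto simp: hits_def c)
  then show ?thesis by (rule bij_betw_same_card)
qed

text \<open>Counting incidences between members and full chains in two ways and dividing by the
  factorial of \<open>card V\<close> turns each member's count into its reciprocal binomial
  coefficient.\<close>

lemma LYM_sum_le:
  assumes V: "finite V" and k: "k \<ge> 2" and F: "\<F> \<subseteq> Pow V"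
    and free: "\<not> contains_Y k \<F>" "\<not> contains_Y_dual k \<F>"
    and ends: "{} \<notin> \<F>" "V \<notin> \<F>"
  shows "(\<Sum>F\<in>\<F>. 1 / real (card V choose card F)) \<le> real k"
proof -
  let ?P = "permutations_of_set V" and ?n = "card V"
  have fin: "finite \<F>" using F V finite_subset by auto
  have "(\<Sum>F\<in>\<F>. fact (card F) * fact (?n - card F)) = (\<Sum>F\<in>\<F>. card {xs \<in> ?P. set (take (card F) xs) = F})"
    using F V by (intro sum.cong) (auto simp: card_permutations_with_prefix)
  also have "\<dots> = (\<Sum>F\<in>\<F>. \<Sum>xs\<in>?P. if set (take (card F) xs) = F then 1 else 0)"
    by (simp add: sum.If_cases Int_def)
  also have "\<dots> = (\<Sum>xs\<in>?P. \<Sum>F\<in>\<F>. if set (take (card F) xs) = F then 1 else 0)"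
    by (rule sum.swap)
  also have "\<dots> = (\<Sum>xs\<in>?P. card (hits \<F> xs))"
    using fin card_hits_eq[OF _ V F] by (intro sum.cong) (auto simp: sum.If_cases Int_def)
  also have "\<dots> \<le> k * fact ?n" by (rule sum_card_hits_le[OF V k free ends])
  finally have *: "(\<Sum>F\<in>\<F>. fact (card F) * fact (?n - card F)) \<le> k * fact ?n" .
  have "1 / real (?n choose card F) = real (fact (card F) * fact (?n - card F)) / fact ?n" if "F \<in> \<F>" for F
    using that F V card_mono[of V F] by (subst binomial_fact) auto
  then have "(\<Sum>F\<in>\<F>. 1 / real (?n choose card F))
      = real (\<Sum>F\<in>\<F>. fact (card F) * fact (?n - card F)) / fact ?n"
    by (simp add: sum_divide_distrib)
  also have "\<dots> \<le> real (k * fact ?n) / fact ?n"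
    using * by (intro divide_right_mono) (auto simp only: of_nat_le_iff fact_ge_zero)
  finally show ?thesis by simp
qed

section \<open>From the weighted sum to the size bound\<close>

text \<open>With \<open>t\<close> the \<open>k\<close>-th largest entry,
  \<open>\<Sum>i. x i * c i \<le> \<Sum>i. x i * (c i - t) + k * t \<le> \<Sum>i. max (c i - t) 0 + k * t\<close>.\<close>

lemma weighted_sum_le_sum_largest:
  fixes x :: "nat \<Rightarrow> real" and cs :: "nat list"
  assumes k: "1 \<le> k" "k \<le> length cs"
    and x: "\<And>i. i < length cs \<Longrightarrow> 0 \<le> x i" "\<And>i. i < length cs \<Longrightarrow> x i \<le> 1"
    and sum: "(\<Sum>i<length cs. x i) \<le> real k"
  shows "(\<Sum>i<length cs. x i * real (cs ! i)) \<le> real (sum_list (take k (rev (sort cs))))"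
proof -
  define ds where "ds = rev (sort cs)"
  define t where "t = ds ! (k - 1)"
  have len: "length ds = length cs" and ms: "mset ds = mset cs" by (simp_all add: ds_def)
  have dec: "ds ! j \<le> ds ! i" if "i \<le> j" "j < length ds" for i j
    using that sorted_rev_nth_mono[of ds i j] by (simp add: ds_def)
  have top: "t \<le> d" if "d \<in> set (take k ds)" for d
    using that k len dec by (auto simp: in_set_conv_nth t_def)
  have bot: "d \<le> t" if "d \<in> set (drop k ds)" for d
    using that k len dec by (auto simp: in_set_conv_nth t_def)
  have "(\<Sum>i<length cs. x i * real (cs ! i))
      = (\<Sum>i<length cs. x i * (real (cs ! i) - real t)) + (\<Sum>i<length cs. x i) * real t"
    by (simp add: sum_distrib_right sum.distrib[symmetric] right_diff_distrib)
  \<comment> \<open>Truncated subtraction on naturals serves as the positive part.\<close>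
  also have "\<dots> \<le> (\<Sum>i<length cs. real (cs ! i - t)) + real k * real t"
  proof (intro add_mono sum_mono mult_right_mono sum)
    fix i assume "i \<in> {..<length cs}"
    then have "0 \<le> x i" "x i \<le> 1" using x by auto
    then show "x i * (real (cs ! i) - real t) \<le> real (cs ! i - t)"
      by (cases "t \<le> cs ! i")
        (auto simp: of_nat_diff mult_left_le_one_le intro!: mult_nonneg_nonpos)
  qed simp
  also have "(\<Sum>i<length cs. real (cs ! i - t)) = real (sum_list (map (\<lambda>c. c - t) cs))"
    by (simp add: sum_list_sum_nth atLeast0LessThan)
  also have "sum_list (map (\<lambda>c. c - t) cs) = sum_list (map (\<lambda>c. c - t) ds)"
    by (metis ms mset_map sum_mset_sum_list)
  also have "\<dots> = sum_list (map (\<lambda>c. c - t) (take k ds)) + sum_list (map (\<lambda>c. c - t) (drop k ds))"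
    by (metis append_take_drop_id map_append sum_list_append)
  \<comment> \<open>Entries after the first \<open>k\<close> are at most \<open>t\<close>, so their
    truncated differences vanish.\<close>
  also have "sum_list (map (\<lambda>c. c - t) (drop k ds)) = 0"
    using bot by (simp add: sum_list_eq_0_iff)
  also have "real (sum_list (map (\<lambda>c. c - t) (take k ds)) + 0) + real k * real t
      = real (sum_list (map (\<lambda>c. c - t) (take k ds)) + sum_list (map (\<lambda>c. t) (take k ds)))"
    using k len by (simp add: sum_list_triv)
  also have "\<dots> = real (sum_list (map (\<lambda>c. (c - t) + t) (take k ds)))"
    by (simp only: sum_list_addf)
  \<comment> \<open>The top \<open>k\<close> entries are at least \<open>t\<close>, so nothing was
    truncated and adding \<open>t\<close> restores them.\<close>
  also have "map (\<lambda>c. (c - t) + t) (take k ds) = take k ds"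
    using top by (intro map_idI) simp
  finally show ?thesis by (simp add: ds_def)
qed

text \<open>Let \<open>x i\<close> be the proportion of level \<open>i\<close> taken up by the
  family. These weights are at most 1 and sum to at most \<open>k\<close>, while weighting the level
  sizes by them gives the size of the family.\<close>

lemma card_le_largest_binomials_sum:
  assumes V: "finite V" and F: "\<F> \<subseteq> Pow V" and k: "1 \<le> k" "k \<le> card V + 1"
    and LYM: "(\<Sum>F\<in>\<F>. 1 / real (card V choose card F)) \<le> real k"
  shows "card \<F> \<le> largest_binomials_sum (card V) k"
proof -
  define n where "n = card V"
  define N where "N i = card {F \<in> \<F>. card F = i}" for i
  define x where "x i = real (N i) / real (n choose i)" for i
  define cs where "cs = map (\<lambda>i. n choose i) [0..<Suc n]"
  have len: "length cs = Suc n" by (simp add: cs_def)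
  have nth: "cs ! i = n choose i" if "i < Suc n" for i
    using that by (simp add: cs_def del: upt_Suc)
  have fin: "finite \<F>" using F V finite_subset by auto
  have le: "card F < Suc n" if "F \<in> \<F>" for F
    using that F V card_mono[of V F] by (auto simp: n_def)
  have pos: "0 < n choose i" if "i < Suc n" for i using that by simp
  \<comment> \<open>Used twice: reciprocal binomials give the sum of the \<open>x i\<close>, the
    constant 1 gives the cardinality.\<close>
  have group: "(\<Sum>F\<in>\<F>. f (card F)) = (\<Sum>i<Suc n. real (N i) * f i)" for f :: "nat \<Rightarrow> real"
  proof -
    have "(\<Sum>F\<in>\<F>. f (card F)) = (\<Sum>i<Suc n. \<Sum>F\<in>{F \<in> \<F>. card F = i}. f (card F))"
      using fin le by (intro sum.group[symmetric]) auto
    then show ?thesis by (simp add: N_def)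
  qed
  have "x i \<le> 1" if "i < Suc n" for i
  proof -
    have "{F \<in> \<F>. card F = i} \<subseteq> {F. F \<subseteq> V \<and> card F = i}" using F by auto
    then have "N i \<le> n choose i"
      using V card_mono[of "{F. F \<subseteq> V \<and> card F = i}" "{F \<in> \<F>. card F = i}"] n_subsets[OF V, of i]
      by (simp add: N_def n_def)
    then show ?thesis using pos[OF that] by (simp add: x_def)
  qed
  moreover have "(\<Sum>i<Suc n. x i) \<le> real k"
    using LYM group[of "\<lambda>i. 1 / real (n choose i)"] by (simp add: x_def n_def)
  ultimately have "(\<Sum>i<length cs. x i * real (cs ! i)) \<le> real (sum_list (take k (rev (sort cs))))"
    \<comment> \<open>Levels 0 to \<open>n\<close> give \<open>n + 1\<close> coefficients, hence the
      bound \<open>k\<close> \<le> \<open>card V + 1\<close>.\<close>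
    using k by (intro weighted_sum_le_sum_largest) (auto simp: len n_def[symmetric] x_def)
  moreover have "(\<Sum>i<length cs. x i * real (cs ! i)) = (\<Sum>i<Suc n. real (N i) * 1)"
    unfolding len using pos by (intro sum.cong) (auto simp: nth x_def)
  moreover have "(\<Sum>i<Suc n. real (N i) * 1) = real (card \<F>)"
    using group[of "\<lambda>_. 1"] by simp
  ultimately show ?thesis by (simp add: largest_binomials_sum_def cs_def n_def)
qed

theorem theorem1p3:
  fixes k n :: nat and \<F> :: "nat set set"
  assumes "k \<ge> 2" and "n \<ge> k + 1"
    and "\<F> \<subseteq> Pow {1..n}"
    and "\<not> contains_Y k \<F>" and "\<not> contains_Y_dual k \<F>"
    and "{} \<notin> \<F>" and "{1..n} \<notin> \<F>"
  shows "(\<Sum>F\<in>\<F>. 1 / real (n choose card F)) \<le> real k \<and>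
         card \<F> \<le> largest_binomials_sum n k"
proof -
  have LYM: "(\<Sum>F\<in>\<F>. 1 / real (card {1..n} choose card F)) \<le> real k"
    using assms by (intro LYM_sum_le) auto
  then have "card \<F> \<le> largest_binomials_sum (card {1..n}) k"
    using assms by (intro card_le_largest_binomials_sum) auto
  then show ?thesis using LYM by simp
qed

end
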